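(* In the financial model (FM) described in the context, let $U\in\mathcal{M}\cap\mathcal{X}_+$ satisfy $\pi(U)=1$, and let $\rho=\rho_{\mathcal{A},\mathcal{M},\pi}:\mathcal{X}\to\overline{\mathbb{R}}$, $\rho(X)=\inf\{\pi(Z)\mid Z\in\mathcal{M},\ X+Z\in\mathcal{A}\}$. Then $$\mathrm{dom}\,\rho:=\{X\in\mathcal{X}\mid\rho(X)<+\infty\}=\mathcal{A}+\ker\pi+\mathbb{R}U=\mathcal{A}+\mathcal{M}.$$ Moreover, for every $X\in\mathcal{X}$, $$\rho(X)\in\mathbb{R}\quad\Longleftrightarrow\quad X\in\mathrm{bd}_{-U}(\mathcal{A}+\ker\pi)+\mathbb{R}U.$$
   Context: Financial model (FM). $\mathcal{X}$ is a real vector space (the capital positions, typically random variables on a probability space $(\Omega,\mathcal{F},\mathbb{P})$ identified $\mathbb{P}$-a.s.), partially ordered by a pointed convex cone $\mathcal{X}_+=\{X\in\mathcal{X}\mid 0\le X\}$ (for random variables, $0\le X$ means $X\ge 0$ $\mathbb{P}$-a.s.). There are eligible assets $S^i=(S_0^i,S_1^i)\in\mathbb{R}\times\mathcal{X}$, $i=0,\dots,N$, with price $S_0^i$ and payoff $S_1^i$; $S^0=(1,1)$ is the secure asset, whose payoff $1\in\mathcal{X}_+$ is the constant payoff. The payoffs are linearly independent, $\mathcal{M}=\mathrm{span}(1,S_1^1,\dots,S_1^N)\subseteq\mathcal{X}$, and $1<\dim\mathcal{M}<+\infty$. For $x\in\mathbb{R}^{N+1}$ put $S_j^Tx=\sum_{i=0}^N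 x_iS_j^i$, $j\in\{0,1\}$. The Law of One Price holds ($S_0^Tx$ depends only on the payoff $S_1^Tx$), so $\pi:\mathcal{M}\to\mathbb{R}$, $\pi(Z):=S_0^Tx$ for any $x$ with $Z=S_1^Tx$, is a well-defined linear functional. The no-arbitrage principle holds: if $S_0^Tx\le 0$ and $S_1^Tx\ge 0$, then $S_0^Tx=0$ and $S_1^Tx=0$. $\mathcal{A}\subseteq\mathcal{X}$ is an acceptance set: $0\in\mathcal{A}$, $\mathcal{A}\neq\mathcal{X}$, $\mathcal{A}+\mathcal{X}_+\subseteq\mathcal{A}$. Notation: $\overline{\mathbb{R}}=\mathbb{R}\cup\{\pm\infty\}$, $\inf\emptyset=+\infty$, $\mathbb{R}_+=[0,\infty)$, $\ker\pi=\{Z\in\mathcal{M}\mid\pi(Z)=0\}$; sums of sets are Minkowski sums, $\mathbb{R}U=\{tU\mid t\in\mathbb{R}\}$. For $\mathcal{B}\subseteq\mathcal{X}$ and $K\in\mathcal{X}\setminus\{0\}$: $\mathrm{cl}_K(\mathcal{B})=\{X\in\mathcal{X}\mid\forall\lambda>0\ \exists t\in\mathbb{R}_+,\ t<\lambda,\ X-tK\in\mathcal{B}\}$, $\mathrm{int}_K(\mathcal{B})=\{X\in\mathcal{X}\mid\exists\lambda>0\ \forall t\in[0,\lambda]:\ X+tK\in\mathcal{B}\}$, $\mathrm{bd}_K(\mathcal{B})=\mathrm{cl}_K(\mathcal{B})\setminus\mathrm{int}_K(\mathcal{B})$. *)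

theory Defs
  imports Complex_Main "HOL-Library.Set_Algebras" "HOL-Library.Extended_Real"
begin

text \<open>
  The ordered space of capital positions is a type of class \<^class>\<open>ordered_real_vector\<close>; its
  positive cone is \<open>{X. 0 \<le> X}\<close>, and antisymmetry of the order says that this cone is pointed.
  The eligible assets are \<open>S 0, \<dots>, S N\<close>, each a pair of price and payoff; a portfolio is a
  function on \<^typ>\<open>nat\<close> of which only the values at \<open>0, \<dots>, N\<close> matter.
\<close>

definition portfolio_price :: "nat \<Rightarrow> (nat \<Rightarrow> real \<times> 'a::real_vector) \<Rightarrow> (nat \<Rightarrow> real) \<Rightarrow> real"
  where "portfolio_price N S x = (\<Sum>i\<le>N. x i * fst (S i))"

definition portfolio_payoff :: "nat \<Rightarrow> (nat \<Rightarrow> real \<times> 'a::real_vector) \<Rightarrow> (nat \<Rightarrow> real) \<Rightarrow> 'a"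
  where "portfolio_payoff N S x = (\<Sum>i\<le>N. x i *\<^sub>R snd (S i))"

definition payoff_space :: "nat \<Rightarrow> (nat \<Rightarrow> real \<times> 'a::real_vector) \<Rightarrow> 'a set"
  where "payoff_space N S = span ((\<lambda>i. snd (S i)) ` {..N})"

text \<open>Meaningful for \<open>Z\<close> in the payoff space, under the Law of One Price.\<close>

definition pricing :: "nat \<Rightarrow> (nat \<Rightarrow> real \<times> 'a::real_vector) \<Rightarrow> 'a \<Rightarrow> real"
  where "pricing N S Z = (THE p. \<exists>x. Z = portfolio_payoff N S x \<and> p = portfolio_price N S x)"

definition pricing_kernel :: "nat \<Rightarrow> (nat \<Rightarrow> real \<times> 'a::real_vector) \<Rightarrow> 'a set"
  where "pricing_kernel N S = {Z \<in> payoff_space N S. pricing N S Z = 0}"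

text \<open>
  Since \<^const>\<open>dim\<close> is \<open>0\<close> on infinite-dimensional spaces, \<open>dim_payoffs\<close> also covers
  finite dimensionality. The parameter \<open>e\<close> is the constant payoff 1.
\<close>

locale financial_model =
  fixes N :: nat
    and S :: "nat \<Rightarrow> real \<times> 'a::ordered_real_vector"
    and e :: 'a
    and A :: "'a set"
  assumes secure_asset: "S 0 = (1, e)"
    and secure_payoff_nonneg: "0 \<le> e"
    and payoffs_distinct: "inj_on (\<lambda>i. snd (S i)) {..N}"
    and payoffs_independent: "independent ((\<lambda>i. snd (S i)) ` {..N})"
    and dim_payoffs: "1 < dim (payoff_space N S)"
    and law_of_one_price:
      "\<And>x y. portfolio_payoff N S x = portfolio_payoff N S y
        \<Longrightarrow> portfolio_price N S x = portfolio_price N S y"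
    and no_arbitrage:
      "\<And>x. portfolio_price N S x \<le> 0 \<Longrightarrow> 0 \<le> portfolio_payoff N S x
        \<Longrightarrow> portfolio_price N S x = 0 \<and> portfolio_payoff N S x = 0"
    and zero_acceptable: "0 \<in> A"
    and acceptance_proper: "A \<noteq> UNIV"
    and acceptance_monotone: "A + {X. 0 \<le> X} \<subseteq> A"

definition risk_measure :: "nat \<Rightarrow> (nat \<Rightarrow> real \<times> 'a::real_vector) \<Rightarrow> 'a set \<Rightarrow> 'a \<Rightarrow> ereal"
  where "risk_measure N S A X = Inf {ereal (pricing N S Z) |Z. Z \<in> payoff_space N S \<and> X + Z \<in> A}"

definition effective_domain :: "('a \<Rightarrow> ereal) \<Rightarrow> 'a set"
  where "effective_domain \<rho> = {X. \<rho> X < \<infinity>}"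

definition line :: "'a::real_vector \<Rightarrow> 'a set"
  where "line U = {t *\<^sub>R U |t. t \<in> (UNIV :: real set)}"

definition dir_closure :: "'a::real_vector \<Rightarrow> 'a set \<Rightarrow> 'a set"
  where "dir_closure K B = {X. \<forall>\<epsilon>>0. \<exists>t. 0 \<le> t \<and> t < \<epsilon> \<and> X - t *\<^sub>R K \<in> B}"

definition dir_interior :: "'a::real_vector \<Rightarrow> 'a set \<Rightarrow> 'a set"
  where "dir_interior K B = {X. \<exists>\<epsilon>>0. \<forall>t\<in>{0..\<epsilon>}. X + t *\<^sub>R K \<in> B}"

definition dir_boundary :: "'a::real_vector \<Rightarrow> 'a set \<Rightarrow> 'a set"
  where "dir_boundary K B = dir_closure K B - dir_interior K B"

end

(* Since Z - pi(Z) U lies in ker pi, the risk measure is rho(X) = inf {p. X + p U : B} with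
   B = A + ker pi, and this set of reals p is upward closed because U is nonnegative. Hence
   X + s U lies in cl_{-U} B iff rho(X) <= s, and in int_{-U} B iff rho(X) < s, so that
   X + s U is a boundary point iff rho(X) = s. *)
theory Submission
  imports Defs
begin

text \<open>A line is closed under negation, so the summand from \<open>line U\<close> can be moved
  to the other side. This turns sums with \<open>line U\<close> into the shifts
  \<open>X + s *\<^sub>R U\<close> used throughout.\<close>

lemma mem_plus_line_iff: "X \<in> B + line U \<longleftrightarrow> (\<exists>s. X + s *\<^sub>R U \<in> B)"
proof
  assume "X \<in> B + line U"
  then obtain b t where "b \<in> B" "X = b + t *\<^sub>R U"
    by (auto simp: line_def set_plus_def)
  then have "X + (- t) *\<^sub>R U \<in> B"
    by simp
  then show "\<exists>s. X + s *\<^sub>R U \<in> B" ..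
next
  assume "\<exists>s. X + s *\<^sub>R U \<in> B"
  then obtain s where "X + s *\<^sub>R U \<in> B" ..
  moreover have "(- s) *\<^sub>R U \<in> line U"
    by (auto simp only: line_def)
  ultimately have "X + s *\<^sub>R U + (- s) *\<^sub>R U \<in> B + line U"
    by (rule set_plus_intro)
  then show "X \<in> B + line U"
    by simp
qed

context financial_model
begin

lemma payoff_space_iff: "Z \<in> payoff_space N S \<longleftrightarrow> (\<exists>x. Z = portfolio_payoff N S x)"
proof
  assume "Z \<in> payoff_space N S"
  then obtain u where "Z = (\<Sum>v\<in>(\<lambda>i. snd (S i)) ` {..N}. u v *\<^sub>R v)"
    unfolding payoff_space_def by (auto simp: span_finite)
  \<comment> \<open>Distinct payoffs let the sum over the set of payoffs be reindexed by asset, so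
    each coefficient becomes a portfolio weight.\<close>
  then have "Z = portfolio_payoff N S (\<lambda>i. u (snd (S i)))"
    using payoffs_distinct by (simp add: portfolio_payoff_def sum.reindex)
  then show "\<exists>x. Z = portfolio_payoff N S x" by blast
next
  show "\<exists>x. Z = portfolio_payoff N S x \<Longrightarrow> Z \<in> payoff_space N S"
    unfolding payoff_space_def portfolio_payoff_def
    by (auto intro: span_sum span_scale span_base)
qed

text \<open>The Law of One Price makes the definite description in \<open>pricing\<close> unique, so
  any replicating portfolio gives the price.\<close>

lemma pricing_payoff: "pricing N S (portfolio_payoff N S x) = portfolio_price N S x"
  unfolding pricing_def by (rule the_equality) (use law_of_one_price in \<open>blast, metis\<close>)

lemma pricing_lincomb:
  assumes "Z \<in> payoff_space N S" "W \<in> payoff_space N S"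
  shows "pricing N S (a *\<^sub>R Z + b *\<^sub>R W) = a * pricing N S Z + b * pricing N S W"
proof -
  obtain x y where x: "Z = portfolio_payoff N S x" and y: "W = portfolio_payoff N S y"
    using assms payoff_space_iff by blast
  have "a *\<^sub>R Z + b *\<^sub>R W = portfolio_payoff N S (\<lambda>i. a * x i + b * y i)"
    by (simp add: x y portfolio_payoff_def scaleR_add_left sum.distrib scaleR_sum_right)
  then show ?thesis
    by (simp add: x y pricing_payoff)
      (simp add: portfolio_price_def distrib_right sum.distrib sum_distrib_left mult.assoc)
qed

lemma payoff_space_lincomb:
  "Z \<in> payoff_space N S \<Longrightarrow> W \<in> payoff_space N S \<Longrightarrow> a *\<^sub>R Z + b *\<^sub>R W \<in> payoff_space N S"
  unfolding payoff_space_def by (intro span_add span_scale)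

text \<open>The nonnegative increment \<open>Y - X\<close> is absorbed by the acceptable summand,
  while the kernel summand stays fixed.\<close>

lemma acceptable_kernel_mono:
  assumes "X \<in> A + pricing_kernel N S" "X \<le> Y"
  shows "Y \<in> A + pricing_kernel N S"
proof -
  obtain a k where a: "a \<in> A" and k: "k \<in> pricing_kernel N S" and X: "X = a + k"
    using assms(1) by (rule set_plus_elim)
  have "a + (Y - X) \<in> A"
    by (rule subsetD[OF acceptance_monotone], rule set_plus_intro) (use a assms(2) in simp_all)
  moreover have "Y = (a + (Y - X)) + k"
    by (simp add: X)
  ultimately show ?thesis
    using k by (metis set_plus_intro)
qed

end

locale priced_unit = financial_model N S e A
  for N :: nat and S :: "nat \<Rightarrow> real \<times> 'a::ordered_real_vector" and e A +
  fixes U :: 'a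
  assumes unit_payoff: "U \<in> payoff_space N S"
    and unit_nonneg: "0 \<le> U"
    and unit_price: "pricing N S U = 1"
begin

text \<open>A payoff of price \<open>p\<close> differs from \<open>p *\<^sub>R U\<close> by an
  element of the kernel, as \<open>U\<close> has price 1. Hedging with all eligible assets thus
  reduces to hedging with \<open>U\<close> alone, once \<open>A\<close> is enlarged by the
  kernel.\<close>

lemma ex_eligible_iff:
  "(\<exists>Z. p = pricing N S Z \<and> Z \<in> payoff_space N S \<and> X + Z \<in> A)
    \<longleftrightarrow> X + p *\<^sub>R U \<in> A + pricing_kernel N S"
proof
  assume "\<exists>Z. p = pricing N S Z \<and> Z \<in> payoff_space N S \<and> X + Z \<in> A"
  then obtain Z where Z: "p = pricing N S Z" "Z \<in> payoff_space N S" "X + Z \<in> A"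
    by blast
  have "p *\<^sub>R U + (- 1) *\<^sub>R Z \<in> pricing_kernel N S"
    using Z(1) payoff_space_lincomb[OF unit_payoff Z(2)] pricing_lincomb[OF unit_payoff Z(2)]
    by (simp only: pricing_kernel_def unit_price mem_Collect_eq) simp
  with Z(3) have "(X + Z) + (p *\<^sub>R U + (- 1) *\<^sub>R Z) \<in> A + pricing_kernel N S"
    by (rule set_plus_intro)
  then show "X + p *\<^sub>R U \<in> A + pricing_kernel N S"
    by simp
next
  assume "X + p *\<^sub>R U \<in> A + pricing_kernel N S"
  then obtain a k where a: "a \<in> A" and k: "k \<in> payoff_space N S" "pricing N S k = 0"
    and eq: "X + p *\<^sub>R U = a + k"
    by (auto simp: pricing_kernel_def elim!: set_plus_elim)
  \<comment> \<open>Solving \<open>X + Z = a\<close> for \<open>Z\<close> gives this payoff;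
    subtracting \<open>k\<close> leaves the price at \<open>p\<close>.\<close>
  let ?Z = "p *\<^sub>R U + (- 1) *\<^sub>R k"
  have "pricing N S ?Z = p"
    by (simp only: pricing_lincomb[OF unit_payoff k(1)] unit_price k(2) mult_1_right mult_zero_right add_0_right)
  moreover have "?Z \<in> payoff_space N S"
    using unit_payoff k(1) by (rule payoff_space_lincomb)
  moreover have "X + ?Z = a"
    using eq by (simp add: algebra_simps)
  ultimately show "\<exists>Z. p = pricing N S Z \<and> Z \<in> payoff_space N S \<and> X + Z \<in> A"
    using a by metis
qed

lemma risk_measure_eq:
  "risk_measure N S A X = (INF p \<in> {p. X + p *\<^sub>R U \<in> A + pricing_kernel N S}. ereal p)"
  unfolding risk_measure_def ex_eligible_iff[symmetric]
  by (rule arg_cong[of _ _ Inf]) auto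

lemma shift_mono:
  assumes "X + p *\<^sub>R U \<in> A + pricing_kernel N S" "p \<le> q"
  shows "X + q *\<^sub>R U \<in> A + pricing_kernel N S"
  using assms(1)
  by (rule acceptable_kernel_mono) (simp add: assms(2) unit_nonneg scaleR_right_mono)

lemma risk_measure_le:
  "X + p *\<^sub>R U \<in> A + pricing_kernel N S \<Longrightarrow> risk_measure N S A X \<le> ereal p"
  by (simp add: risk_measure_eq INF_lower)

text \<open>The infimum need not be attained, but a strict bound yields an admissible price below
  \<open>p\<close>, and \<open>shift_mono\<close> raises it to \<open>p\<close>.\<close>

lemma shift_if_risk_measure_less:
  assumes "risk_measure N S A X < ereal p"
  shows "X + p *\<^sub>R U \<in> A + pricing_kernel N S"
  using assms shift_mono by (auto simp: risk_measure_eq INF_less_iff intro: less_imp_le)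

text \<open>Subtracting \<open>t *\<^sub>R (- U)\<close> adds capital, so the closure asks for
  admissible prices at or arbitrarily little above \<open>s\<close>.\<close>

lemma dir_closure_iff:
  "X + s *\<^sub>R U \<in> dir_closure (- U) (A + pricing_kernel N S) \<longleftrightarrow> risk_measure N S A X \<le> ereal s"
proof
  assume cl: "X + s *\<^sub>R U \<in> dir_closure (- U) (A + pricing_kernel N S)"
  show "risk_measure N S A X \<le> ereal s"
  proof (rule ereal_le_epsilon2)
    fix \<epsilon> :: real
    assume "0 < \<epsilon>"
    then obtain t where "t < \<epsilon>" "X + (s + t) *\<^sub>R U \<in> A + pricing_kernel N S"
      using cl by (auto simp: dir_closure_def scaleR_add_left add.assoc)
    then show "risk_measure N S A X \<le> ereal s + ereal \<epsilon>"
      using risk_measure_le[of X "s + \<epsilon>"] shift_mono[of X "s + t" "s + \<epsilon>"] by simp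
  qed
next
  assume le: "risk_measure N S A X \<le> ereal s"
  have "\<exists>t. 0 \<le> t \<and> t < \<epsilon> \<and> X + s *\<^sub>R U - t *\<^sub>R (- U) \<in> A + pricing_kernel N S" if "\<epsilon> > 0" for \<epsilon> :: real
  proof -
    \<comment> \<open>Halving keeps the shift strictly below \<open>\<epsilon>\<close> while making
      the bound on the risk measure strict.\<close>
    have "risk_measure N S A X < ereal (s + \<epsilon> / 2)"
      using le by (rule le_less_trans) (simp add: that)
    from shift_if_risk_measure_less[OF this] show ?thesis
      using that by (intro exI[of _ "\<epsilon> / 2"]) (simp add: scaleR_add_left add.assoc)
  qed
  then show "X + s *\<^sub>R U \<in> dir_closure (- U) (A + pricing_kernel N S)"
    by (simp add: dir_closure_def)
qed

text \<open>Adding \<open>t *\<^sub>R (- U)\<close> withdraws capital, so interior points are those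
  with some admissible price strictly below \<open>s\<close>.\<close>

lemma dir_interior_iff:
  "X + s *\<^sub>R U \<in> dir_interior (- U) (A + pricing_kernel N S) \<longleftrightarrow> risk_measure N S A X < ereal s"
proof
  assume "X + s *\<^sub>R U \<in> dir_interior (- U) (A + pricing_kernel N S)"
  \<comment> \<open>The right endpoint \<open>t = \<epsilon>\<close> of the interval already
    supplies the strict gap.\<close>
  then obtain \<epsilon> where \<epsilon>: "\<epsilon> > 0" "X + (s - \<epsilon>) *\<^sub>R U \<in> A + pricing_kernel N S"
    by (force simp: dir_interior_def scaleR_diff_left algebra_simps)
  from risk_measure_le[OF \<epsilon>(2)] show "risk_measure N S A X < ereal s"
    by (rule le_less_trans) (simp add: \<epsilon>(1))
next
  assume "risk_measure N S A X < ereal s"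
  then obtain q where q: "X + q *\<^sub>R U \<in> A + pricing_kernel N S" "q < s"
    by (auto simp: risk_measure_eq INF_less_iff)
  \<comment> \<open>Withdrawing at most \<open>s - q\<close> leaves the price at or above
    \<open>q\<close>, which is admissible.\<close>
  have "X + s *\<^sub>R U + t *\<^sub>R (- U) \<in> A + pricing_kernel N S" if "t \<le> s - q" for t
    using shift_mono[OF q(1), of "s - t"] that by (simp add: algebra_simps)
  then show "X + s *\<^sub>R U \<in> dir_interior (- U) (A + pricing_kernel N S)"
    unfolding dir_interior_def using q(2) by (auto intro!: exI[of _ "s - q"])
qed

lemma dir_boundary_iff:
  "X + s *\<^sub>R U \<in> dir_boundary (- U) (A + pricing_kernel N S) \<longleftrightarrow> risk_measure N S A X = ereal s"
  by (auto simp: dir_boundary_def dir_closure_iff dir_interior_iff)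

lemma effective_domain_eq:
  "effective_domain (risk_measure N S A) = A + pricing_kernel N S + line U"
  \<comment> \<open>\<open>ereal_infty_less\<close> would turn the strict inequality into a
    disequality, hiding it from \<open>INF_less_iff\<close>.\<close>
  by (simp add: effective_domain_def set_eq_iff mem_plus_line_iff risk_measure_eq INF_less_iff
      del: ereal_infty_less)

lemma acceptable_kernel_line_eq: "A + pricing_kernel N S + line U = A + payoff_space N S"
proof (rule set_eqI)
  fix X
  \<comment> \<open>Quantifying over all prices \<open>p\<close> in \<open>ex_eligible_iff\<close>
    removes the price constraint on \<open>Z\<close>.\<close>
  have "X \<in> A + pricing_kernel N S + line U \<longleftrightarrow> (\<exists>Z\<in>payoff_space N S. X + Z \<in> A)"
    unfolding mem_plus_line_iff ex_eligible_iff[symmetric] by blast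
  also have "\<dots> \<longleftrightarrow> X \<in> A + payoff_space N S"
  proof
    assume "\<exists>Z\<in>payoff_space N S. X + Z \<in> A"
    then obtain Z where "X + Z \<in> A" "- Z \<in> payoff_space N S"
      unfolding payoff_space_def by (auto intro: span_neg)
    then have "X + Z + - Z \<in> A + payoff_space N S"
      by (rule set_plus_intro)
    then show "X \<in> A + payoff_space N S"
      by simp
  next
    assume "X \<in> A + payoff_space N S"
    then obtain a Z where "a \<in> A" "Z \<in> payoff_space N S" "X = a + Z"
      by (rule set_plus_elim)
    then have "- Z \<in> payoff_space N S" "X + - Z \<in> A"
      unfolding payoff_space_def by (auto intro: span_neg)
    then show "\<exists>Z\<in>payoff_space N S. X + Z \<in> A" ..
  qed
  finally show "X \<in> A + pricing_kernel N S + line U \<longleftrightarrow> X \<in> A + payoff_space N S" .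
qed

end

theorem theorem5p19:
  fixes N :: nat
    and S :: "nat \<Rightarrow> real \<times> 'a::ordered_real_vector"
    and e U :: 'a
    and A :: "'a set"
  assumes "financial_model N S e A"
    and "U \<in> payoff_space N S" and "0 \<le> U"
    and "pricing N S U = 1"
  shows "effective_domain (risk_measure N S A) = A + pricing_kernel N S + line U
    \<and> A + pricing_kernel N S + line U = A + payoff_space N S
    \<and> (\<forall>X. risk_measure N S A X \<in> range ereal
          \<longleftrightarrow> X \<in> dir_boundary (- U) (A + pricing_kernel N S) + line U)"
proof -
  interpret priced_unit N S e A U
    using assms by (simp add: priced_unit_def priced_unit_axioms_def)
  show ?thesis
    \<comment> \<open>The boundary condition becomes the existence of a real \<open>s\<close> equal
      to the risk measure, which is membership in \<open>range ereal\<close>.\<close>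
    unfolding effective_domain_eq mem_plus_line_iff[where B = "dir_boundary _ _"] dir_boundary_iff
    using acceptable_kernel_line_eq by blast
qed

end
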